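(* Let $q$ be an odd prime power of characteristic $p$, and let $\{x_k\}_{k\in[n]}$ be a family in $\mathbb{F}_{q^2}^d$. Consider the statements: (a) $\{x_k\}_{k\in[n]}$ is a projective $2$-design (i.e. an $(a,c_1,c_2)$-projective $2$-design for some $a,c_1,c_2\in\mathbb{F}_q$); (b) $n=d^2$; (c) there exist $a,b,c_1\in\mathbb{F}_q$ such that (i) $a^2\neq b$; (ii) if $a\neq0$ then $a^2-b=\frac{bc_1}{a}$; (iii) if $a=0$ then $d\equiv -1 \pmod p$; and (iv) $\{x_k\}_{k\in[n]}$ is an $(a,b,c_1)$-equiangular tight frame for $\mathbb{F}_{q^2}^d$. Any two of (a), (b), (c) together imply the third. Moreover, when (a), (b), (c) hold, $\{x_k\}_{k\in[n]}$ is an $(a,c_1,c_2)$-projective $2$-design with $c_2=2(a^2-b)$ (with $a,b,c_1$ as in (c)).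
   Context: For $a\in\mathbb{F}_{q^2}$ write $\overline{a}=a^q$; $A^*$ is conjugate transpose; $\langle x,y\rangle=x^*y$ on $\mathbb{F}_{q^2}^d$ and analogously on $(\mathbb{F}_{q^2}^d)^{\otimes 2}$. A subspace $V$ is nondegenerate if $V\cap V^\perp=\{0\}$. For nondegenerate $V$, a family $\{y_k\}_{k\in[n]}$ in $V$ is a $c$-tight frame for $V$ ($c\in\mathbb{F}_q$) if $\operatorname{span}\{y_k\}=V$ and $\sum_k\langle y_k,y\rangle y_k=cy$ for all $y\in V$. It is an $(a,b,c)$-equiangular tight frame ($a,b,c\in\mathbb{F}_q$) if moreover $\langle y_k,y_k\rangle=a$ for all $k$ and $\langle y_k,y_\ell\rangle\langle y_\ell,y_k\rangle=b$ for all $k\neq\ell$. $(\mathbb{F}_{q^2}^d)^{\otimes2}_{\mathrm{sym}}=\{\sum_{i,j}c_{ij}e_i\otimes e_j:c_{ij}=c_{ji}\}$ is nondegenerate with orthogonal projection $\Pi_d^{(2)}=\frac12\sum_{i,j}(e_ie_i^*\otimes e_je_j^*+e_ie_j^*\otimes e_je_i^* )$. A family $\{x_k\}_{k\in[n]}$ in $\mathbb{F}_{q^2}^d$ is an $(a,c_1,c_2)$-projective $2$-design if (i) $\langle x_k,x_k\rangle=a$ for all $k$, (ii) $\{x_k\}$ is a $c_1$-tight frame for $\mathbb{F}_{q^2}^d$, and (iii) $\{x_k\otimes x_k\}$ is a $c_2$-tight frame for $(\mathbb{F}_{q^2}^d)^{\otimes 2}_{\mathrm{sym}}$. Integers such as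 $d$ are viewed in $\mathbb{F}_q$ via reduction mod $p$. *)

theory Defs
  imports Main "HOL-Library.Cardinality" "HOL-Computational_Algebra.Primes"
begin

text \<open>Ambient field: a finite field 'a (intended F_{q^2}); conjugation a \<mapsto> a^q.
  Vectors in F_{q^2}^d are functions 'i \<Rightarrow> 'a on a finite index type 'i with d = CARD('i);
  the tensor square is indexed by 'i \<times> 'i.  Families are indexed by k < n.\<close>

definition conjq :: "nat \<Rightarrow> 'a::field \<Rightarrow> 'a" where
  "conjq q a = a ^ q"

definition in_Fq :: "nat \<Rightarrow> 'a::field \<Rightarrow> bool" where
  "in_Fq q c \<longleftrightarrow> conjq q c = c"

definition herm :: "nat \<Rightarrow> ('i::finite \<Rightarrow> 'a::field) \<Rightarrow> ('i \<Rightarrow> 'a) \<Rightarrow> 'a" where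
  "herm q x y = (\<Sum>i\<in>UNIV. conjq q (x i) * y i)"

definition lin_span :: "(nat \<Rightarrow> ('i \<Rightarrow> 'a::field)) \<Rightarrow> nat \<Rightarrow> ('i \<Rightarrow> 'a) set" where
  "lin_span y n = {v. \<exists>c. v = (\<lambda>i. \<Sum>k<n. c k * y k i)}"

definition nondegenerate :: "nat \<Rightarrow> ('i::finite \<Rightarrow> 'a::field) set \<Rightarrow> bool" where
  "nondegenerate q V \<longleftrightarrow> V \<inter> {x. \<forall>v\<in>V. herm q v x = 0} = {(\<lambda>_. 0)}"

definition tight_frame :: "nat \<Rightarrow> ('i::finite \<Rightarrow> 'a::field) set \<Rightarrow> (nat \<Rightarrow> ('i \<Rightarrow> 'a)) \<Rightarrow> nat \<Rightarrow> 'a \<Rightarrow> bool" where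
  "tight_frame q V y n c \<longleftrightarrow> nondegenerate q V \<and> in_Fq q c \<and> (\<forall>k<n. y k \<in> V) \<and>
     lin_span y n = V \<and>
     (\<forall>v\<in>V. (\<lambda>i. \<Sum>k<n. herm q (y k) v * y k i) = (\<lambda>i. c * v i))"

definition etf :: "nat \<Rightarrow> ('i::finite \<Rightarrow> 'a::field) set \<Rightarrow> (nat \<Rightarrow> ('i \<Rightarrow> 'a)) \<Rightarrow> nat \<Rightarrow> 'a \<Rightarrow> 'a \<Rightarrow> 'a \<Rightarrow> bool" where
  "etf q V y n a b c \<longleftrightarrow> in_Fq q a \<and> in_Fq q b \<and> tight_frame q V y n c \<and>
     (\<forall>k<n. herm q (y k) (y k) = a) \<and>
     (\<forall>k<n. \<forall>l<n. k \<noteq> l \<longrightarrow> herm q (y k) (y l) * herm q (y l) (y k) = b)"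

definition sym_space :: "('i \<times> 'i \<Rightarrow> 'a::field) set" where
  "sym_space = {v. \<forall>i j. v (i, j) = v (j, i)}"

definition tensor :: "('i \<Rightarrow> 'a::field) \<Rightarrow> ('i \<Rightarrow> 'a) \<Rightarrow> ('i \<times> 'i \<Rightarrow> 'a)" where
  "tensor x y = (\<lambda>(i, j). x i * y j)"

definition proj_2design :: "nat \<Rightarrow> (nat \<Rightarrow> ('i::finite \<Rightarrow> 'a::field)) \<Rightarrow> nat \<Rightarrow> 'a \<Rightarrow> 'a \<Rightarrow> 'a \<Rightarrow> bool" where
  "proj_2design q x n a c1 c2 \<longleftrightarrow> in_Fq q a \<and>
     (\<forall>k<n. herm q (x k) (x k) = a) \<and>
     tight_frame q UNIV x n c1 \<and>
     tight_frame q sym_space (\<lambda>k. tensor (x k) (x k)) n c2"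

end

theory Submission
  imports Defs "HOL-Library.FuncSet" "HOL-Number_Theory.Residues"
begin

text \<open>Let P_k be the rank-one matrix x_k x_k^*, let d = CARD('i), and set P'_k = P_k if a \<noteq> 0 and
  P'_k = P_k + I if a = 0. The design property says \<Sum>_k tr(P_k M) P_k = h (M + tr(M) I) for all M,
  with h = c2/2; for h \<noteq> 0 it follows that the P'_k span all d \<times> d matrices. Equiangularity makes
  (tr(P_k P_l)) equal to (a^2 - b) I + b J, from which the P'_k are linearly independent. So a family
  with both properties has d^2 members, and for d^2 members either property makes the P'_k a
  basis: for a design, the angles are read off by comparing coefficients in
  \<Sum>_k tr(P_k P_l) P_k = h (P_l + a I), and for an equiangular tight frame the operator identity is
  checked on the basis. The degenerate case c2 = 0 is excluded because a 0-tight frame for the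
  symmetric square has more than d^2 members.\<close>

section \<open>Linear independence and spanning by counting over a finite field\<close>

definition lin_indep :: "(nat \<Rightarrow> 'j \<Rightarrow> 'a::field) \<Rightarrow> nat \<Rightarrow> bool" where
  "lin_indep y n \<longleftrightarrow> (\<forall>c. (\<forall>j. (\<Sum>k<n. c k * y k j) = 0) \<longrightarrow> (\<forall>k<n. c k = 0))"

lemma card_coeffs: "card ({..<n} \<rightarrow>\<^sub>E (UNIV :: 'a::finite set)) = CARD('a) ^ n"
  by (simp add: card_PiE)

text \<open>Extensional coefficient families on \<open>{..<n}\<close> form a finite set of size
  \<open>CARD('a) ^ n\<close>, and restricting coefficients does not change the combination.
  Dimension arguments thereby become counting arguments.\<close>

lemma lin_span_eq_image:
  "lin_span y n = (\<lambda>c j. \<Sum>k<n. c k * y k j) ` ({..<n} \<rightarrow>\<^sub>E UNIV)"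
proof -
  have "(\<lambda>j. \<Sum>k<n. c k * y k j) = (\<lambda>j. \<Sum>k<n. restrict c {..<n} k * y k j)"
    for c :: "nat \<Rightarrow> 'b"
    by simp
  moreover have "restrict c {..<n} \<in> {..<n} \<rightarrow>\<^sub>E UNIV" for c :: "nat \<Rightarrow> 'b"
    by auto
  ultimately show ?thesis
    unfolding lin_span_def by blast
qed

lemma lin_indep_iff_inj_on:
  "lin_indep y n \<longleftrightarrow> inj_on (\<lambda>c j. \<Sum>k<n. c k * y k j) ({..<n} \<rightarrow>\<^sub>E UNIV)" (is "?L \<longleftrightarrow> inj_on ?T ?W")
proof
  assume ?L
  show "inj_on ?T ?W"
  proof (rule inj_onI)
    fix c d assume cd: "c \<in> ?W" "d \<in> ?W" "?T c = ?T d"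
    have "(\<Sum>k<n. (c k - d k) * y k j) = 0" for j
      using fun_cong[OF cd(3), of j] by (simp add: left_diff_distrib sum_subtractf)
    with \<open>?L\<close>[unfolded lin_indep_def, rule_format, of "\<lambda>k. c k - d k"] have "\<forall>k<n. c k = d k"
      by simp
    with cd(1,2) show "c = d"
      by (intro PiE_ext[of c "{..<n}" _ d]) auto
  qed
next
  assume inj: "inj_on ?T ?W"
  show ?L
    unfolding lin_indep_def
  proof (intro allI impI)
    fix c k assume c: "\<forall>j. (\<Sum>k<n. c k * y k j) = 0" and k: "k < n"
    \<comment> \<open>Members of \<open>?W\<close> are \<open>undefined\<close> outside
      \<open>{..<n}\<close>, so the zero coefficients have to be restricted as well.\<close>
    have "?T (restrict c {..<n}) = ?T (restrict (\<lambda>_. 0) {..<n})"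
      using c by simp
    then have "restrict c {..<n} = restrict (\<lambda>_. 0) {..<n}"
      by (intro inj_onD[OF inj]) auto
    then show "c k = 0"
      using k by (metis lessThan_iff restrict_apply')
  qed
qed

lemma card_field_gt_1: "1 < CARD('a::{field,finite})"
  using card_mono[of UNIV "{0, 1 :: 'a}"] by simp

text \<open>The synthesis map injects |F|^n coefficient families into |F|^|J| vectors, where F is
  the field and J the index type; the exponents compare because |F| > 1.\<close>

lemma lin_indep_le_card:
  fixes y :: "nat \<Rightarrow> 'j::finite \<Rightarrow> 'a::{field,finite}"
  assumes "lin_indep y n"
  shows "n \<le> CARD('j)"
proof -
  have "CARD('a) ^ n \<le> CARD('j \<Rightarrow> 'a)"
    unfolding card_coeffs[symmetric]
    by (rule card_inj_on_le[OF assms[unfolded lin_indep_iff_inj_on]]) auto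
  then show ?thesis
    using card_field_gt_1[where ?'a = 'a] by (simp add: card_fun)
qed

lemma card_le_lin_span:
  fixes y :: "nat \<Rightarrow> 'j::finite \<Rightarrow> 'a::{field,finite}"
  assumes "lin_span y n = UNIV"
  shows "CARD('j) \<le> n"
proof -
  have "CARD('j \<Rightarrow> 'a) \<le> CARD('a) ^ n"
    unfolding card_coeffs[symmetric] assms[symmetric] lin_span_eq_image
    by (rule card_image_le) (simp add: finite_PiE)
  then show ?thesis
    using card_field_gt_1[where ?'a = 'a] by (simp add: card_fun)
qed

text \<open>Coefficient space and vector space have the same finite size, so the synthesis map is
  injective exactly when it is surjective.\<close>

lemma lin_indep_iff_lin_span:
  fixes y :: "nat \<Rightarrow> 'j::finite \<Rightarrow> 'a::{field,finite}"
  assumes n: "n = CARD('j)"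
  shows "lin_indep y n \<longleftrightarrow> lin_span y n = UNIV"
proof -
  define W where "W = {..<n} \<rightarrow>\<^sub>E (UNIV :: 'a set)"
  define T :: "(nat \<Rightarrow> 'a) \<Rightarrow> 'j \<Rightarrow> 'a" where "T = (\<lambda>c j. \<Sum>k<n. c k * y k j)"
  have fin: "finite W" and card: "card W = CARD('j \<Rightarrow> 'a)"
    by (simp_all add: W_def finite_PiE card_coeffs card_fun n)
  have "inj_on T W \<longleftrightarrow> card (T ` W) = card W"
    using fin by (metis card_image eq_card_imp_inj_on)
  also have "\<dots> \<longleftrightarrow> T ` W = UNIV"
    unfolding card by (metis card_eq_UNIV_imp_eq_UNIV finite)
  finally show ?thesis
    by (simp add: lin_indep_iff_inj_on lin_span_eq_image W_def T_def)
qed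

section \<open>The symmetric square\<close>

text \<open>A counting form of d^2 < d(d+1): a matrix splits into its upper triangle with diagonal
  and its strict lower triangle, each reflected to a symmetric matrix.\<close>

lemma card_matrices_less_card_sym_space_squared:
  "CARD('i::finite \<times> 'i \<Rightarrow> 'a::{field,finite})
     < card (sym_space :: ('i \<times> 'i \<Rightarrow> 'a) set) ^ 2"
proof -
  \<comment> \<open>The injection into the naturals orders the index type, which tells the two
    triangles apart.\<close>
  obtain f :: "'i \<Rightarrow> nat" where f: "inj f"
    using finite_imp_inj_to_nat_seg[OF finite, of "UNIV :: 'i set"] by blast
  define S where "S = (sym_space :: ('i \<times> 'i \<Rightarrow> 'a) set)"
  define g :: "('i \<times> 'i \<Rightarrow> 'a) \<Rightarrow> ('i \<times> 'i \<Rightarrow> 'a) \<times> ('i \<times> 'i \<Rightarrow> 'a)" where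
    "g M = ((\<lambda>(i, j). if f i \<le> f j then M (i, j) else M (j, i)),
            (\<lambda>(i, j). if i = j then 0 else if f i < f j then M (j, i) else M (i, j)))" for M
  have "inj g"
  proof (rule injI)
    fix M N assume eq: "g M = g N"
    show "M = N"
    proof
      fix u :: "'i \<times> 'i"
      obtain i j where u: "u = (i, j)" by fastforce
      have e1: "(if f i \<le> f j then M (i, j) else M (j, i)) = (if f i \<le> f j then N (i, j) else N (j, i))"
        using fun_cong[OF arg_cong[OF eq, of fst], of "(i, j)"] by (simp add: g_def)
      have e2: "(if i = j then 0 else if f i < f j then M (j, i) else M (i, j)) =
                (if i = j then 0 else if f i < f j then N (j, i) else N (i, j))"
        using fun_cong[OF arg_cong[OF eq, of snd], of "(i, j)"] by (simp add: g_def)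
      show "M u = N u"
        unfolding u using e1 e2 by (cases "f i \<le> f j") (auto split: if_splits)
    qed
  qed
  have "range g \<subset> S \<times> S"
  proof
    show "range g \<subseteq> S \<times> S"
      by (auto simp: g_def S_def sym_space_def dest: injD[OF f] split: if_splits)
    \<comment> \<open>The lower-triangle part always has zero diagonal, so the pair of all-ones
      matrices is missed and the inclusion is strict.\<close>
    define one :: "'i \<times> 'i \<Rightarrow> 'a" where "one = (\<lambda>_. 1)"
    have "snd (g M) (i, i) \<noteq> snd (one, one) (i, i)" for M i
      by (simp add: g_def one_def)
    then have "(one, one) \<notin> range g"
      by (metis imageE)
    moreover have "(one, one) \<in> S \<times> S"
      by (simp add: S_def sym_space_def one_def)
    ultimately show "range g \<noteq> S \<times> S"
      by blast
  qed
  then have "card (range g) < card (S \<times> S)"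
    by (intro psubset_card_mono) auto
  then show ?thesis
    unfolding card_image[OF \<open>inj g\<close>] by (simp add: S_def card_cartesian_product power2_eq_square)
qed

section \<open>Conjugation and tight frames\<close>

lemma conjq_mult: "conjq q (u * v) = conjq q u * conjq q v"
  by (simp add: conjq_def power_mult_distrib)

lemma prime_CHAR_finite_field: "prime CHAR('a::{field,finite})"
  by (rule prime_CHAR_semidom[OF finite_imp_CHAR_pos]) simp

text \<open>As q is a power of the characteristic, conjugation is a power of the Frobenius
  map.\<close>

lemma conjq_sum:
  fixes f :: "'k \<Rightarrow> 'a::{field,finite}"
  assumes "q = CHAR('a) ^ m"
  shows "conjq q (\<Sum>k\<in>A. f k) = (\<Sum>k\<in>A. conjq q (f k))"
  unfolding conjq_def by (rule freshmans_dream_sum') (simp_all add: assms prime_CHAR_finite_field)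

lemma in_Fq_add:
  fixes u v :: "'a::{field,finite}"
  assumes "q = CHAR('a) ^ m" "in_Fq q u" "in_Fq q v"
  shows "in_Fq q (u + v)"
proof -
  have "(u + v) ^ q = u ^ q + v ^ q"
    using assms(1) by (intro freshmans_dream') (simp_all add: prime_CHAR_finite_field)
  with assms(2,3) show ?thesis by (simp add: in_Fq_def conjq_def)
qed

lemma in_Fq_mult: "in_Fq q u \<Longrightarrow> in_Fq q v \<Longrightarrow> in_Fq q (u * v)"
  by (simp add: in_Fq_def conjq_mult)

lemma in_Fq_divide: "in_Fq q u \<Longrightarrow> in_Fq q v \<Longrightarrow> in_Fq q (u / v)"
  by (simp add: in_Fq_def conjq_def power_divide)

lemma in_Fq_uminus: "odd q \<Longrightarrow> in_Fq q u \<Longrightarrow> in_Fq q (- u)"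
  by (simp add: in_Fq_def conjq_def)

lemma in_Fq_1: "in_Fq q 1"
  by (simp add: in_Fq_def conjq_def)

lemma herm_lincomb_left:
  fixes y :: "nat \<Rightarrow> 'j::finite \<Rightarrow> 'a::{field,finite}"
  assumes "q = CHAR('a) ^ m"
  shows "herm q (\<lambda>j. \<Sum>k<n. c k * y k j) v = (\<Sum>k<n. conjq q (c k) * herm q (y k) v)"
  unfolding herm_def conjq_sum[OF assms] conjq_mult sum_distrib_right sum_distrib_left
  by (subst sum.swap) (simp add: mult.assoc)

lemma herm_diff_right: "herm q u (\<lambda>j. v j - w j) = herm q u v - herm q u w"
  by (simp add: herm_def right_diff_distrib sum_subtractf)

text \<open>For a 0-tight frame, the range of the analysis operator lies in the kernel of the
  synthesis operator; adding a section of the latter gives an injection of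
  V \<times> V into the coefficient space.\<close>

lemma zero_tight_frame_card:
  fixes y :: "nat \<Rightarrow> 'j::finite \<Rightarrow> 'a::{field,finite}"
  assumes q: "q = CHAR('a) ^ m" and tf: "tight_frame q V y n 0"
  shows "card V ^ 2 \<le> CARD('a) ^ n"
proof -
  define W where "W = {..<n} \<rightarrow>\<^sub>E (UNIV :: 'a set)"
  define T :: "(nat \<Rightarrow> 'a) \<Rightarrow> 'j \<Rightarrow> 'a" where "T = (\<lambda>c j. \<Sum>k<n. c k * y k j)"
  have span: "lin_span y n = V" and nd: "nondegenerate q V"
    and zero: "\<And>v j. v \<in> V \<Longrightarrow> (\<Sum>k<n. herm q (y k) v * y k j) = 0"
    using tf by (auto simp: tight_frame_def fun_eq_iff)
  have V: "V = T ` W"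
    using span by (simp add: lin_span_eq_image T_def W_def)
  define g where "g = (\<lambda>(w, v). \<lambda>k\<in>{..<n}. inv_into W T w k + herm q (y k) v)"
  have Tg: "T (g (w, v)) = w" if "w \<in> V" "v \<in> V" for w v
  proof
    fix j
    have "T (g (w, v)) j = T (inv_into W T w) j + (\<Sum>k<n. herm q (y k) v * y k j)"
      by (simp add: T_def g_def distrib_right sum.distrib)
    also have "\<dots> = w j"
      using that by (simp add: V f_inv_into_f zero[OF that(2)])
    finally show "T (g (w, v)) j = w j" .
  qed
  have "inj_on g (V \<times> V)"
  proof (rule inj_onI, clarify)
    fix w v w' v' assume in_V: "w \<in> V" "v \<in> V" "w' \<in> V" "v' \<in> V" and eq: "g (w, v) = g (w', v')"
    have w: "w = w'"
      using Tg[of w v] Tg[of w' v'] in_V eq by simp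
    have herm_eq: "herm q (y k) v = herm q (y k) v'" if "k < n" for k
      using fun_cong[OF eq, of k] that by (simp add: g_def w)
    \<comment> \<open>Equal analysis coefficients make v - v' orthogonal to every
      \<open>y k\<close>, hence to their span V; nondegeneracy then gives v = v'.\<close>
    have "herm q u (\<lambda>j. v j - v' j) = 0" if u_in: "u \<in> V" for u
    proof -
      obtain c where u: "u = (\<lambda>j. \<Sum>k<n. c k * y k j)"
        using u_in unfolding span[symmetric] lin_span_def by blast
      show ?thesis
        unfolding u herm_lincomb_left[OF q] herm_diff_right using herm_eq by simp
    qed
    moreover have "(\<lambda>j. v j - v' j) \<in> V"
    proof -
      obtain c d where "v = (\<lambda>j. \<Sum>k<n. c k * y k j)" "v' = (\<lambda>j. \<Sum>k<n. d k * y k j)"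
        using in_V unfolding span[symmetric] lin_span_def by blast
      then have "(\<lambda>j. v j - v' j) = (\<lambda>j. \<Sum>k<n. (c k - d k) * y k j)"
        by (simp add: left_diff_distrib sum_subtractf)
      then show ?thesis
        unfolding span[symmetric] lin_span_def by (intro CollectI exI[of _ "\<lambda>k. c k - d k"])
    qed
    ultimately have "(\<lambda>j. v j - v' j) \<in> V \<inter> {x. \<forall>v\<in>V. herm q v x = 0}"
      by blast
    then have "(\<lambda>j. v j - v' j) = (\<lambda>_. 0)"
      using nd unfolding nondegenerate_def by simp
    then show "w = w' \<and> v = v'"
      using w by (simp add: fun_eq_iff)
  qed
  moreover have "g ` (V \<times> V) \<subseteq> W"
    by (auto simp: g_def W_def split: if_splits)
  ultimately have "card (V \<times> V) \<le> card W"
    by (rule card_inj_on_le) (simp add: W_def finite_PiE)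
  then show ?thesis
    by (simp add: W_def card_coeffs card_cartesian_product power2_eq_square)
qed

text \<open>For the symmetric square V, |F|^(d^2) < |V|^2 \<le> |F|^n. This later excludes the
  constant 0 whenever n \<le> d^2.\<close>

lemma zero_tight_frame_sym_space_length:
  fixes y :: "nat \<Rightarrow> 'i::finite \<times> 'i \<Rightarrow> 'a::{field,finite}"
  assumes "q = CHAR('a) ^ m" and "tight_frame q sym_space y n 0"
  shows "CARD('i) ^ 2 < n"
proof -
  have "CARD('i \<times> 'i \<Rightarrow> 'a) < CARD('a) ^ n"
    using card_matrices_less_card_sym_space_squared[where ?'a = 'a and ?'i = 'i] zero_tight_frame_card[OF assms]
    by (rule less_le_trans)
  then show ?thesis
    using card_field_gt_1[where ?'a = 'a] by (simp add: card_fun power2_eq_square)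
qed

section \<open>Rank-one matrices\<close>

definition outer :: "nat \<Rightarrow> ('i \<Rightarrow> 'a::field) \<Rightarrow> 'i \<Rightarrow> 'i \<Rightarrow> 'a" where
  "outer q u i j = u i * conjq q (u j)"

text \<open>This is tr(MN) with no conjugation, so it is linear in both arguments.\<close>

definition trace_prod :: "('i::finite \<Rightarrow> 'i \<Rightarrow> 'a::field) \<Rightarrow> ('i \<Rightarrow> 'i \<Rightarrow> 'a) \<Rightarrow> 'a" where
  "trace_prod M N = (\<Sum>r\<in>UNIV. \<Sum>s\<in>UNIV. M r s * N s r)"

definition mtrace :: "('i::finite \<Rightarrow> 'i \<Rightarrow> 'a::field) \<Rightarrow> 'a" where
  "mtrace M = (\<Sum>i\<in>UNIV. M i i)"

lemma sum_of_bool_left: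
  fixes f :: "'i::finite \<Rightarrow> 'a::field"
  shows "(\<Sum>i\<in>UNIV. of_bool (i = j) * f i) = f j" "(\<Sum>i\<in>UNIV. of_bool (j = i) * f i) = f j"
    "(\<Sum>i\<in>UNIV. f i * of_bool (i = j)) = f j" "(\<Sum>i\<in>UNIV. f i * of_bool (j = i)) = f j"
  by (simp_all add: of_bool_def if_distrib if_distribR cong: if_cong)

lemma mtrace_outer: "mtrace (outer q u) = herm q u u"
  by (simp add: mtrace_def outer_def herm_def mult.commute)

lemma trace_prod_outer: "trace_prod (outer q u) (outer q v) = herm q u v * herm q v u"
  unfolding trace_prod_def outer_def herm_def
  by (subst mult.commute[of "sum _ _"], subst sum_product) (simp add: mult_ac)

text \<open>The multiple of the identity is kept separate because shifted matrices produce it; an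
  empty sum gives scalar matrices, and t = 0 gives plain combinations.\<close>

lemma trace_prod_lincomb:
  fixes N :: "nat \<Rightarrow> 'i::finite \<Rightarrow> 'i \<Rightarrow> 'a::field"
  shows "trace_prod M (\<lambda>i j. (\<Sum>k<n. c k * N k i j) + t * of_bool (i = j))
       = (\<Sum>k<n. c k * trace_prod M (N k)) + t * mtrace M"
proof -
  have "trace_prod M (\<lambda>i j. \<Sum>k<n. c k * N k i j) = (\<Sum>k<n. c k * trace_prod M (N k))"
  proof -
    have "trace_prod M (\<lambda>i j. \<Sum>k<n. c k * N k i j)
        = (\<Sum>r\<in>UNIV. \<Sum>s\<in>UNIV. \<Sum>k<n. c k * (M r s * N k s r))"
      by (simp add: trace_prod_def sum_distrib_left mult_ac)
    also have "\<dots> = (\<Sum>r\<in>UNIV. \<Sum>k<n. \<Sum>s\<in>UNIV. c k * (M r s * N k s r))"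
      by (intro sum.cong refl sum.swap)
    also have "\<dots> = (\<Sum>k<n. \<Sum>r\<in>UNIV. \<Sum>s\<in>UNIV. c k * (M r s * N k s r))"
      by (rule sum.swap)
    finally show ?thesis
      by (simp add: trace_prod_def sum_distrib_left)
  qed
  moreover have "trace_prod M (\<lambda>i j. t * of_bool (i = j)) = t * mtrace M"
  proof -
    have "trace_prod M (\<lambda>i j. t * of_bool (i = j))
        = (\<Sum>r\<in>UNIV. \<Sum>s\<in>UNIV. of_bool (s = r) * (t * M r s))"
      by (simp add: trace_prod_def mult_ac)
    then show ?thesis
      by (simp only: sum_of_bool_left mtrace_def sum_distrib_left)
  qed
  ultimately show ?thesis
    by (simp add: trace_prod_def distrib_left sum.distrib)
qed

lemma mtrace_lincomb:
  fixes N :: "nat \<Rightarrow> 'i::finite \<Rightarrow> 'i \<Rightarrow> 'a::field"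
  shows "mtrace (\<lambda>i j. (\<Sum>k<n. c k * N k i j) + t * of_bool (i = j))
       = (\<Sum>k<n. c k * mtrace (N k)) + t * of_nat CARD('i)"
  unfolding mtrace_def sum.distrib sum_distrib_left by (subst sum.swap) (simp add: mult.commute)

text \<open>The fourth-moment form of the design property: the displayed sum, reindexed, is the matrix of
  \<open>\<Sum>\<^sub>k (x\<^sub>k \<otimes> x\<^sub>k)(x\<^sub>k \<otimes> x\<^sub>k)\<^sup>*\<close>, and the right-hand side that of \<open>2h\<close> times the projection
  onto symmetric tensors.\<close>

definition fourth_moment :: "nat \<Rightarrow> (nat \<Rightarrow> 'i \<Rightarrow> 'a::field) \<Rightarrow> nat \<Rightarrow> 'a \<Rightarrow> bool" where
  "fourth_moment q x n h \<longleftrightarrow> (\<forall>r s i j. (\<Sum>k<n. outer q (x k) r s * outer q (x k) i j)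
     = h * (of_bool (r = s) * of_bool (i = j) + of_bool (r = j) * of_bool (s = i)))"

text \<open>Contracting the entries with \<open>M s r\<close> turns the two delta terms into tr(M) I
  and M; conversely, matrix units M recover the entries.\<close>

lemma fourth_moment_iff_operator:
  fixes x :: "nat \<Rightarrow> 'i::finite \<Rightarrow> 'a::field"
  shows "fourth_moment q x n h \<longleftrightarrow>
    (\<forall>M i j. (\<Sum>k<n. trace_prod (outer q (x k)) M * outer q (x k) i j)
       = h * (M i j + mtrace M * of_bool (i = j)))" (is "_ \<longleftrightarrow> ?R")
proof
  assume fm: "fourth_moment q x n h"
  show ?R
  proof (intro allI)
    fix M :: "'i \<Rightarrow> 'i \<Rightarrow> 'a" and i j
    have "(\<Sum>k<n. trace_prod (outer q (x k)) M * outer q (x k) i j)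
        = (\<Sum>k<n. \<Sum>r\<in>UNIV. \<Sum>s\<in>UNIV. M s r * (outer q (x k) r s * outer q (x k) i j))"
      by (simp add: trace_prod_def sum_distrib_right sum_distrib_left mult_ac)
    also have "\<dots> = (\<Sum>r\<in>UNIV. \<Sum>k<n. \<Sum>s\<in>UNIV. M s r * (outer q (x k) r s * outer q (x k) i j))"
      by (rule sum.swap)
    also have "\<dots> = (\<Sum>r\<in>UNIV. \<Sum>s\<in>UNIV. \<Sum>k<n. M s r * (outer q (x k) r s * outer q (x k) i j))"
      by (intro sum.cong refl sum.swap)
    also have "\<dots> = (\<Sum>r\<in>UNIV. \<Sum>s\<in>UNIV. M s r *
        (h * (of_bool (r = s) * of_bool (i = j) + of_bool (r = j) * of_bool (s = i))))"
      using fm by (simp add: fourth_moment_def flip: sum_distrib_left)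
    also have "\<dots> = (\<Sum>r\<in>UNIV. \<Sum>s\<in>UNIV. of_bool (r = s) * (h * of_bool (i = j) * M s r))
        + (\<Sum>r\<in>UNIV. of_bool (r = j) * (\<Sum>s\<in>UNIV. of_bool (s = i) * (h * M s r)))"
      by (simp add: distrib_left sum.distrib sum_distrib_left mult_ac)
    also have "\<dots> = h * (M i j + mtrace M * of_bool (i = j))"
      unfolding sum_of_bool_left mtrace_def by (simp add: distrib_left sum_distrib_left sum_distrib_right mult_ac)
    finally show "(\<Sum>k<n. trace_prod (outer q (x k)) M * outer q (x k) i j)
        = h * (M i j + mtrace M * of_bool (i = j))" .
  qed
next
  assume ?R
  show "fourth_moment q x n h"
    unfolding fourth_moment_def
  proof (intro allI)
    fix r s i j
    define M :: "'i \<Rightarrow> 'i \<Rightarrow> 'a" where "M = (\<lambda>s' r'. of_bool (s' = s) * of_bool (r' = r))"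
    have "trace_prod N M = N r s" for N
    proof -
      have "trace_prod N M = (\<Sum>r'\<in>UNIV. of_bool (r' = r) * (\<Sum>s'\<in>UNIV. of_bool (s' = s) * N r' s'))"
        by (simp only: trace_prod_def M_def sum_distrib_left mult_ac)
      then show ?thesis
        by (simp only: sum_of_bool_left)
    qed
    moreover have "mtrace M = of_bool (s = r)"
      by (simp only: mtrace_def M_def sum_of_bool_left)
    ultimately show "(\<Sum>k<n. outer q (x k) r s * outer q (x k) i j)
        = h * (of_bool (r = s) * of_bool (i = j) + of_bool (r = j) * of_bool (s = i))"
      using \<open>?R\<close>[rule_format, of M i j] by (auto simp: M_def)
  qed
qed

section \<open>Frame operators of tensor squares\<close>

lemma herm_tensor:
  "herm q (tensor u u) v = (\<Sum>r\<in>UNIV. \<Sum>s\<in>UNIV. conjq q (u r) * conjq q (u s) * v (r, s))"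
  unfolding herm_def UNIV_Times_UNIV[symmetric]
  by (simp add: sum.cartesian_product tensor_def conjq_mult case_prod_beta)

text \<open>The matrix of (x_k \<otimes> x_k)(x_k \<otimes> x_k)^* has the entry
  \<open>outer q (x k) i r * outer q (x k) j s\<close> in row (i, j) and column (r, s), so the frame
  operator consists of fourth moments.\<close>

lemma tensor_frame_eq:
  fixes x :: "nat \<Rightarrow> 'i::finite \<Rightarrow> 'a::field"
  shows "(\<Sum>k<n. herm q (tensor (x k) (x k)) v * tensor (x k) (x k) (i, j))
    = (\<Sum>r\<in>UNIV. \<Sum>s\<in>UNIV. v (r, s) * (\<Sum>k<n. outer q (x k) i r * outer q (x k) j s))"
proof -
  have "(\<Sum>k<n. herm q (tensor (x k) (x k)) v * tensor (x k) (x k) (i, j))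
    = (\<Sum>k<n. \<Sum>r\<in>UNIV. \<Sum>s\<in>UNIV. v (r, s) * (outer q (x k) i r * outer q (x k) j s))"
    unfolding herm_tensor by (simp add: tensor_def outer_def sum_distrib_right sum_distrib_left mult_ac)
  also have "\<dots> = (\<Sum>r\<in>UNIV. \<Sum>k<n. \<Sum>s\<in>UNIV. v (r, s) * (outer q (x k) i r * outer q (x k) j s))"
    by (rule sum.swap)
  also have "\<dots> = (\<Sum>r\<in>UNIV. \<Sum>s\<in>UNIV. \<Sum>k<n. v (r, s) * (outer q (x k) i r * outer q (x k) j s))"
    by (intro sum.cong refl sum.swap)
  finally show ?thesis
    by (simp add: sum_distrib_left)
qed

text \<open>The frame identity is tested on e_s \<otimes> e_j + e_j \<otimes> e_s at position (r,
  i). The two resulting fourth moments differ by an exchange of the conjugated factors and so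
  coincide; hence the division by 2.\<close>

lemma tight_frame_sym_space_imp_fourth_moment:
  fixes x :: "nat \<Rightarrow> 'i::finite \<Rightarrow> 'a::field"
  assumes two: "(2::'a) \<noteq> 0" and tf: "tight_frame q sym_space (\<lambda>k. tensor (x k) (x k)) n c"
  shows "fourth_moment q x n (c / 2)"
  unfolding fourth_moment_def
proof (intro allI)
  fix r s i j
  define v :: "'i \<times> 'i \<Rightarrow> 'a" where
    "v = (\<lambda>(i', j'). of_bool (i' = s) * of_bool (j' = j) + of_bool (i' = j) * of_bool (j' = s))"
  define K where "K = (\<Sum>k<n. outer q (x k) r s * outer q (x k) i j)"
  define L where "L r' s' = (\<Sum>k<n. outer q (x k) r r' * outer q (x k) i s')" for r' s'
  have "v \<in> sym_space"
    by (simp add: sym_space_def v_def mult.commute add.commute)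
  then have "c * v (r, i) = (\<Sum>k<n. herm q (tensor (x k) (x k)) v * tensor (x k) (x k) (r, i))"
    using tf by (simp add: tight_frame_def fun_eq_iff)
  also have "\<dots> = (\<Sum>r'\<in>UNIV. of_bool (r' = s) * (\<Sum>s'\<in>UNIV. of_bool (s' = j) * L r' s'))
     + (\<Sum>r'\<in>UNIV. of_bool (r' = j) * (\<Sum>s'\<in>UNIV. of_bool (s' = s) * (\<Sum>k<n. outer q (x k) r r' * outer q (x k) i s')))"
    unfolding tensor_frame_eq L_def[symmetric] by (simp only: v_def prod.case distrib_right sum.distrib sum_distrib_left mult.assoc)
  also have "\<dots> = K + (\<Sum>k<n. outer q (x k) r j * outer q (x k) i s)"
    by (simp only: sum_of_bool_left K_def L_def)
  also have "\<dots> = 2 * K"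
    by (simp add: K_def outer_def mult_ac)
  finally show "K = c / 2 * (of_bool (r = s) * of_bool (i = j) + of_bool (r = j) * of_bool (s = i))"
    using two by (simp add: v_def field_simps eq_commute[of i s])
qed

text \<open>Pairing w with the symmetric indicator of {(i, j), (j, i)} returns w (i, j) on the
  diagonal and twice that off it.\<close>

lemma nondegenerate_sym_space:
  assumes q: "q > 0" and two: "(2::'a::field) \<noteq> 0"
  shows "nondegenerate q (sym_space :: ('i::finite \<times> 'i \<Rightarrow> 'a) set)"
  unfolding nondegenerate_def
proof (intro equalityI subsetI)
  fix w :: "'i \<times> 'i \<Rightarrow> 'a" assume w: "w \<in> sym_space \<inter> {x. \<forall>v\<in>sym_space. herm q v x = 0}"
  have "w (i, j) = 0" for i j
  proof -
    define v :: "'i \<times> 'i \<Rightarrow> 'a" where "v = (\<lambda>u. of_bool (u = (i, j) \<or> u = (j, i)))"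
    have "v \<in> sym_space"
      by (auto simp: sym_space_def v_def)
    with w have "0 = herm q v w"
      by simp
    also have "\<dots> = (\<Sum>u\<in>UNIV. of_bool (u = (i, j) \<or> u = (j, i)) * w u)"
      \<comment> \<open>Since \<open>q > 0\<close>, also \<open>0 ^ q = 0\<close>, so the 0-1
        entries of v are fixed by conjugation.\<close>
      unfolding herm_def v_def conjq_def using q by (intro sum.cong refl) simp
    also have "\<dots> = sum w {(i, j), (j, i)}"
      by (rule sum.mono_neutral_cong_right) auto
    also have "\<dots> = (if i = j then w (i, j) else 2 * w (i, j))"
      using w by (auto simp: sym_space_def)
    finally show ?thesis
      using two by (simp split: if_splits)
  qed
  then show "w \<in> {\<lambda>_. 0}"
    by (auto simp: fun_eq_iff)
next
  fix w :: "'i \<times> 'i \<Rightarrow> 'a" assume "w \<in> {\<lambda>_. 0}"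
  then show "w \<in> sym_space \<inter> {x. \<forall>v\<in>sym_space. herm q v x = 0}"
    by (simp add: sym_space_def herm_def)
qed

text \<open>The frame operator is 2h times the identity on symmetric tensors; as 2h \<noteq> 0,
  dividing the frame identity by 2h also proves spanning.\<close>

lemma fourth_moment_imp_tight_frame_sym_space:
  fixes x :: "nat \<Rightarrow> 'i::finite \<Rightarrow> 'a::field"
  assumes q: "q > 0" and two: "(2::'a) \<noteq> 0" and h: "h \<noteq> 0" "in_Fq q (2 * h)"
    and fm: "fourth_moment q x n h"
  shows "tight_frame q sym_space (\<lambda>k. tensor (x k) (x k)) n (2 * h)"
proof -
  let ?y = "\<lambda>k. tensor (x k) (x k)"
  have y_sym: "?y k \<in> sym_space" for k
    by (simp add: sym_space_def tensor_def mult.commute)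
  have frame: "(\<Sum>k<n. herm q (?y k) v * ?y k u) = 2 * h * v u" if "v \<in> sym_space" for v u
  proof -
    obtain i j where u: "u = (i, j)" by fastforce
    have "(\<Sum>k<n. herm q (?y k) v * ?y k u)
      = (\<Sum>r\<in>UNIV. \<Sum>s\<in>UNIV. v (r, s) * (h * (of_bool (i = r) * of_bool (j = s) + of_bool (i = s) * of_bool (r = j))))"
      unfolding u tensor_frame_eq using fm by (simp add: fourth_moment_def)
    also have "\<dots> = (\<Sum>r\<in>UNIV. of_bool (i = r) * (\<Sum>s\<in>UNIV. of_bool (j = s) * (h * v (r, s))))
       + (\<Sum>r\<in>UNIV. of_bool (r = j) * (\<Sum>s\<in>UNIV. of_bool (i = s) * (h * v (r, s))))"
      by (simp add: distrib_left sum.distrib sum_distrib_left mult_ac)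
    also have "\<dots> = h * v (i, j) + h * v (j, i)"
      by (simp only: sum_of_bool_left)
    also have "\<dots> = 2 * h * v u"
      using that by (simp add: sym_space_def u)
    finally show ?thesis .
  qed
  have "lin_span ?y n = sym_space"
  proof (intro equalityI subsetI)
    fix v assume "v \<in> lin_span ?y n"
    then show "v \<in> sym_space"
      by (auto simp: lin_span_def sym_space_def tensor_def mult.commute)
  next
    fix v :: "'i \<times> 'i \<Rightarrow> 'a" assume v: "v \<in> sym_space"
    have "v = (\<lambda>u. \<Sum>k<n. herm q (?y k) v / (2 * h) * ?y k u)"
    proof
      fix u
      have "(\<Sum>k<n. herm q (?y k) v / (2 * h) * ?y k u) = (\<Sum>k<n. herm q (?y k) v * ?y k u) / (2 * h)"
        by (simp add: sum_divide_distrib)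
      also have "\<dots> = v u"
        using h two by (simp add: frame[OF v])
      finally show "v u = (\<Sum>k<n. herm q (?y k) v / (2 * h) * ?y k u)" ..
    qed
    then show "v \<in> lin_span ?y n"
      unfolding lin_span_def by (intro CollectI exI)
  qed
  then show ?thesis
    unfolding tight_frame_def
    using nondegenerate_sym_space[OF q two] h y_sym frame by (auto simp: fun_eq_iff)
qed

section \<open>Equal-norm tight frames\<close>

text \<open>Common ground of designs and equiangular tight frames, with tightness in the matrix form
  \<Sum>_k P_k = c1 I.\<close>

locale equal_norm_tight_frame =
  fixes q n :: nat and x :: "nat \<Rightarrow> 'i::finite \<Rightarrow> 'a::{field,finite}" and a c1 :: 'a
  assumes norm: "k < n \<Longrightarrow> herm q (x k) (x k) = a"
    and frame: "(\<Sum>k<n. outer q (x k) i j) = c1 * of_bool (i = j)"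
begin

definition angle :: "nat \<Rightarrow> nat \<Rightarrow> 'a" where
  "angle k l = herm q (x k) (x l) * herm q (x l) (x k)"

lemma angle_commute: "angle k l = angle l k"
  by (simp add: angle_def mult.commute)

lemma trace_prod_eq_angle: "trace_prod (outer q (x k)) (outer q (x l)) = angle k l"
  by (simp add: trace_prod_outer angle_def)

lemma angle_diag: "k < n \<Longrightarrow> angle k k = a ^ 2"
  by (simp add: angle_def norm power2_eq_square)

text \<open>Take traces in \<Sum>_k P_k = c1 I.\<close>

lemma trace_eq: "of_nat n * a = of_nat CARD('i) * c1"
proof -
  have "of_nat n * a = (\<Sum>k<n. mtrace (outer q (x k)))"
    by (simp add: mtrace_outer norm)
  also have "\<dots> = (\<Sum>i\<in>UNIV. \<Sum>k<n. outer q (x k) i i)"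
    unfolding mtrace_def by (rule sum.swap)
  finally show ?thesis
    by (simp add: frame)
qed

lemma sum_angle:
  assumes "l < n"
  shows "(\<Sum>k<n. angle k l) = c1 * a"
proof -
  \<comment> \<open>Both descriptions of \<Sum>_k P_k = c1 I are put into the shape of
    \<open>trace_prod_lincomb\<close>, once with t = 0 and once with an empty sum.\<close>
  have "(\<Sum>k<n. angle k l) = trace_prod (outer q (x l)) (\<lambda>i j. (\<Sum>k<n. 1 * outer q (x k) i j) + 0 * of_bool (i = j))"
    unfolding trace_prod_lincomb by (simp add: trace_prod_eq_angle angle_commute)
  also have "\<dots> = trace_prod (outer q (x l)) (\<lambda>i j. (\<Sum>k<0. 0 * outer q (x k) i j) + c1 * of_bool (i = j))"
    by (simp add: frame)
  also have "\<dots> = c1 * a"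
    unfolding trace_prod_lincomb by (simp add: mtrace_outer norm assms)
  finally show ?thesis .
qed

text \<open>If a = 0, the rank-one matrices sum to zero, and adding the identity to each restores their
  independence.\<close>

definition shifted :: "nat \<Rightarrow> 'i \<times> 'i \<Rightarrow> 'a" where
  "shifted k = (\<lambda>(i, j). outer q (x k) i j + of_bool (a = 0) * of_bool (i = j))"

text \<open>In the first case \<Sum>_k P_k = c1 I puts I into the span of the P_k. In the second the
  P_k sum to 0, while the shifted matrices sum to n I = I and have trace d = -1.\<close>

definition balanced :: bool where
  "balanced \<longleftrightarrow> a \<noteq> 0 \<and> c1 \<noteq> 0 \<or>
     a = 0 \<and> c1 = 0 \<and> of_nat n = (1 :: 'a) \<and> of_nat CARD('i) = (- 1 :: 'a)"

lemma sum_shifted: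
  "(\<Sum>k<n. c k * shifted k (i, j))
     = (\<Sum>k<n. c k * outer q (x k) i j) + (of_bool (a = 0) * (\<Sum>k<n. c k)) * of_bool (i = j)"
  by (simp add: shifted_def distrib_left sum.distrib sum_distrib_left sum_distrib_right mult_ac)

text \<open>Taking M = I in the operator form gives a c1 I = h (d + 1) I; one diagonal entry is
  compared.\<close>

lemma fourth_moment_trace:
  assumes "fourth_moment q x n h"
  shows "a * c1 = h * (of_nat CARD('i) + 1)"
proof -
  define i :: 'i where "i = undefined"
  define I :: "'i \<Rightarrow> 'i \<Rightarrow> 'a" where "I = (\<lambda>i j. of_bool (i = j))"
  have I: "I = (\<lambda>i j. (\<Sum>k<0. 0 * I i j) + 1 * of_bool (i = j))"
    by (simp add: I_def)
  have tr: "mtrace I = of_nat CARD('i)"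
    by (simp add: mtrace_def I_def)
  have "trace_prod M I = mtrace M" for M
    by (subst I, subst trace_prod_lincomb) simp
  then have "a * c1 = (\<Sum>k<n. trace_prod (outer q (x k)) I * outer q (x k) i i)"
    by (simp add: mtrace_outer norm frame flip: sum_distrib_left)
  also have "\<dots> = h * (of_nat CARD('i) + 1)"
    using assms[unfolded fourth_moment_iff_operator, rule_format, of I i i] tr by (simp add: I_def add.commute)
  finally show ?thesis .
qed

section \<open>Consequences of equiangularity\<close>

text \<open>The vector c is multiplied by the angle matrix (a^2 - b) I + b J.\<close>

lemma equiangular_sum_angle:
  assumes l: "l < n" and equi: "\<And>k l. k < n \<Longrightarrow> l < n \<Longrightarrow> k \<noteq> l \<Longrightarrow> angle k l = b"
  shows "(\<Sum>k<n. c k * angle k l) = c l * (a ^ 2 - b) + b * (\<Sum>k<n. c k)"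
proof -
  have "(\<Sum>k<n. c k * angle k l) = (\<Sum>k<n. (if k = l then c k * (a ^ 2 - b) else 0) + b * c k)"
    using l by (intro sum.cong refl) (auto simp: angle_diag equi algebra_simps)
  then show ?thesis
    using l by (simp add: sum.distrib sum_distrib_left)
qed

text \<open>If a \<noteq> 0, then c1 = 0 would force a^2 = b. If a = 0, traces give c1 = 0, and a
  row sum of the angle matrix gives b n = b with b \<noteq> 0.\<close>

lemma equiangular_imp_balanced:
  assumes n: "0 < n" and equi: "\<And>k l. k < n \<Longrightarrow> l < n \<Longrightarrow> k \<noteq> l \<Longrightarrow> angle k l = b"
    and ab: "a ^ 2 \<noteq> b" and "a \<noteq> 0 \<Longrightarrow> a ^ 2 - b = b * c1 / a"
    and "a = 0 \<Longrightarrow> of_nat CARD('i) = (- 1 :: 'a)"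
  shows balanced
proof (cases "a = 0")
  case False
  with assms(4) ab show ?thesis
    by (auto simp: balanced_def)
next
  case True
  have d: "of_nat CARD('i) = (- 1 :: 'a)"
    using assms(5) True .
  have c1: "c1 = 0"
    using trace_eq True by (simp add: d)
  have "c1 * a = (a ^ 2 - b) + b * of_nat n"
    using sum_angle[OF n] equiangular_sum_angle[OF n equi, where c = "\<lambda>_. 1"] by simp
  then have "b * of_nat n = b * 1"
    using True by simp
  then have "of_nat n = (1 :: 'a)"
    using ab True by (subst (asm) mult_cancel_left) auto
  with True c1 d show ?thesis
    unfolding balanced_def by blast
qed

text \<open>Pairing a relation with P_l gives c_l (a^2 - b) + b s = 0, where s is the sum of the
  coefficients, so it suffices to show s = 0.\<close>

lemma equiangular_imp_lin_indep:
  assumes balanced and equi: "\<And>k l. k < n \<Longrightarrow> l < n \<Longrightarrow> k \<noteq> l \<Longrightarrow> angle k l = b"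
    and ab: "a ^ 2 \<noteq> b"
  shows "lin_indep shifted n"
  unfolding lin_indep_def
proof (intro allI impI)
  fix c l assume c: "\<forall>u. (\<Sum>k<n. c k * shifted k u) = 0" and l: "l < n"
  define s where "s = (\<Sum>k<n. c k)"
  define t :: 'a where "t = of_bool (a = 0) * s"
  have comb: "(\<lambda>i j. (\<Sum>k<n. c k * outer q (x k) i j) + t * of_bool (i = j)) = (\<lambda>i j. 0)"
    using c sum_shifted[of c] by (simp add: t_def s_def)
  \<comment> \<open>The shift is present only for a = 0, where tr(P_l) = a makes its contribution
    vanish.\<close>
  have "t * a = 0"
    by (simp add: t_def)
  have eq: "c l * (a ^ 2 - b) + b * s = 0" if "l < n" for l
  proof -
    have "0 = trace_prod (outer q (x l)) (\<lambda>i j. (\<Sum>k<n. c k * outer q (x k) i j) + t * of_bool (i = j))"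
      unfolding comb by (simp add: trace_prod_def)
    also have "\<dots> = (\<Sum>k<n. c k * angle k l)"
      unfolding trace_prod_lincomb using \<open>t * a = 0\<close> that
      by (simp add: trace_prod_eq_angle mtrace_outer norm angle_commute)
    finally show ?thesis
      using equiangular_sum_angle[OF that equi] by (simp add: s_def)
  qed
  \<comment> \<open>For a = 0 the trace of the relation is s d = -s. For a \<noteq> 0, summing the
    equations over l gives s c1 a = 0.\<close>
  have "s = 0"
  proof (cases "a = 0")
    case True
    have "0 = mtrace (\<lambda>i j. (\<Sum>k<n. c k * outer q (x k) i j) + t * of_bool (i = j))"
      unfolding comb by (simp add: mtrace_def)
    also have "\<dots> = - s"
      unfolding mtrace_lincomb using True \<open>balanced\<close>[unfolded balanced_def] by (simp add: mtrace_outer norm t_def)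
    finally show ?thesis by simp
  next
    case False
    have "0 = (\<Sum>l<n. c l * (a ^ 2 - b) + b * s)"
      using eq by simp
    also have "\<dots> = s * ((a ^ 2 - b) + b * of_nat n)"
      unfolding sum.distrib sum_distrib_right[symmetric] s_def[symmetric] by (simp add: algebra_simps)
    also have "(a ^ 2 - b) + b * of_nat n = c1 * a"
      using sum_angle[OF l] equiangular_sum_angle[OF l equi, where c = "\<lambda>_. 1"] by simp
    finally show ?thesis
      using \<open>balanced\<close> False by (simp add: balanced_def)
  qed
  then show "c l = 0"
    using eq[OF l] ab by simp
qed

text \<open>Expanding M in the shifted matrices makes tr(P_k M) explicit. The operator identity then
  reduces to comparing multiples of I.\<close>

lemma equiangular_imp_fourth_moment:
  assumes bal: balanced and equi: "\<And>k l. k < n \<Longrightarrow> l < n \<Longrightarrow> k \<noteq> l \<Longrightarrow> angle k l = b"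
    and bc: "a \<noteq> 0 \<Longrightarrow> a ^ 2 - b = b * c1 / a"
    and span: "lin_span shifted n = UNIV"
  shows "fourth_moment q x n (a ^ 2 - b)"
  unfolding fourth_moment_iff_operator
proof (intro allI)
  fix M :: "'i \<Rightarrow> 'i \<Rightarrow> 'a" and i j
  define h where "h = a ^ 2 - b"
  obtain c where c: "(\<lambda>(i, j). M i j) = (\<lambda>u. \<Sum>k<n. c k * shifted k u)"
    using span unfolding lin_span_def by blast
  define s where "s = (\<Sum>k<n. c k)"
  define t :: 'a where "t = of_bool (a = 0) * s"
  have M: "M = (\<lambda>i j. (\<Sum>k<n. c k * outer q (x k) i j) + t * of_bool (i = j))"
    unfolding t_def s_def sum_shifted[symmetric] using c by (auto simp: fun_eq_iff)
  have trM: "mtrace M = s * a + t * of_nat CARD('i)"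
    unfolding M mtrace_lincomb by (simp add: mtrace_outer norm s_def sum_distrib_right)
  have tp: "trace_prod (outer q (x k)) M = c k * h + b * s + t * a" if "k < n" for k
    unfolding M trace_prod_lincomb using equiangular_sum_angle[OF that equi] that
    by (simp add: trace_prod_eq_angle angle_commute mtrace_outer norm h_def s_def)
  have "(\<Sum>k<n. trace_prod (outer q (x k)) M * outer q (x k) i j)
     = (\<Sum>k<n. h * (c k * outer q (x k) i j) + (b * s + t * a) * outer q (x k) i j)"
    by (intro sum.cong refl) (simp add: tp algebra_simps)
  also have "\<dots> = h * (\<Sum>k<n. c k * outer q (x k) i j) + (b * s + t * a) * c1 * of_bool (i = j)"
    by (simp add: sum.distrib frame mult.assoc flip: sum_distrib_left)
  also have "(\<Sum>k<n. c k * outer q (x k) i j) = M i j - t * of_bool (i = j)"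
    by (simp add: M)
  also have "h * (M i j - t * of_bool (i = j)) + (b * s + t * a) * c1 * of_bool (i = j)
     = h * M i j + ((b * s + t * a) * c1 - h * t) * of_bool (i = j)"
    by (simp add: algebra_simps)
  \<comment> \<open>For a = 0: t = s, c1 = 0 and tr M = s d = -s. For a \<noteq> 0: t = 0, b c1 = h
    a and tr M = s a.\<close>
  also have "(b * s + t * a) * c1 - h * t = h * mtrace M"
  proof (cases "a = 0")
    case True
    with bal[unfolded balanced_def] show ?thesis
      by (simp add: trM)
  next
    case False
    then have "b * c1 = h * a"
      using bc by (simp add: h_def)
    with False show ?thesis
      by (simp add: trM t_def algebra_simps)
  qed
  finally show "(\<Sum>k<n. trace_prod (outer q (x k)) M * outer q (x k) i j)
      = (a ^ 2 - b) * (M i j + mtrace M * of_bool (i = j))"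
    by (simp add: h_def distrib_left mult.assoc)
qed

section \<open>Consequences of the fourth-moment identity\<close>

text \<open>Solving the operator form for M writes M as a combination of the P_k and I, and I lies
  in the span because the family is balanced.\<close>

lemma fourth_moment_imp_lin_span:
  assumes bal: balanced and fm: "fourth_moment q x n h" and h: "h \<noteq> 0"
  shows "lin_span shifted n = UNIV"
proof -
  define z :: 'a where "z = of_bool (a = 0)"
  define e where "e = (if a = 0 then 1 else 1 / c1)"
  have id: "(\<Sum>k<n. e * shifted k (i, j)) = of_bool (i = j)" for i j
    unfolding sum_shifted using bal
    by (auto simp: frame balanced_def e_def simp flip: sum_distrib_left)
  have "v \<in> lin_span shifted n" for v
  proof -
    define M where "M = (\<lambda>i j. v (i, j))"
    define t where "t k = trace_prod (outer q (x k)) M" for k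
    define S where "S = (\<Sum>k<n. t k)"
    \<comment> \<open>The part t_k / h yields M + (tr M + z S / h) I, with z S / h caused by the
      shift; the part with e subtracts this multiple of I.\<close>
    define d where "d k = (t k / h) + (- z * S / h - mtrace M) * e" for k
    have "v (i, j) = (\<Sum>k<n. d k * shifted k (i, j))" for i j
    proof -
      have "(\<Sum>k<n. d k * shifted k (i, j)) =
         (\<Sum>k<n. t k * shifted k (i, j)) / h + (- z * S / h - mtrace M) * (\<Sum>k<n. e * shifted k (i, j))"
        by (simp add: d_def distrib_right sum.distrib sum_distrib_left sum_divide_distrib mult.assoc)
      also have "(\<Sum>k<n. t k * shifted k (i, j)) = h * (M i j + mtrace M * of_bool (i = j)) + z * S * of_bool (i = j)"
        unfolding sum_shifted t_def using fm[unfolded fourth_moment_iff_operator]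
        by (simp add: z_def S_def t_def)
      finally show ?thesis
        using h by (simp add: id M_def field_simps)
    qed
    then have "v = (\<lambda>u. \<Sum>k<n. d k * shifted k u)"
      by (simp add: fun_eq_iff)
    then show ?thesis
      unfolding lin_span_def by (intro CollectI exI)
  qed
  then show ?thesis by blast
qed

text \<open>For M = P_l the operator form equates two combinations of the P_k, once a I is expressed
  through \<Sum>_k P_k; independence of the shifted matrices compares coefficients.\<close>

lemma fourth_moment_imp_equiangular:
  assumes bal: balanced and fm: "fourth_moment q x n h" and indep: "lin_indep shifted n"
    and kl: "k < n" "l < n"
  shows "angle k l = h * of_bool (k = l) + (if a = 0 then - h else h * a / c1)"
proof -
  \<comment> \<open>For a \<noteq> 0 the value is chosen so that b \<Sum>_k P_k = h a I. For a = 0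
    the P_k sum to 0, and -h is chosen so that the \<open>g k\<close> sum to 0, which cancels the
    shift.\<close>
  define b where "b = (if a = 0 then - h else h * a / c1)"
  define g where "g k = angle k l - h * of_bool (k = l) - b" for k
  have g_outer: "(\<Sum>k<n. g k * outer q (x k) i j) = 0" for i j
  proof -
    have "(\<Sum>k<n. h * of_bool (k = l) * outer q (x k) i j) = (\<Sum>k\<in>{l}. h * outer q (x k) i j)"
      by (rule sum.mono_neutral_cong_right) (use kl in auto)
    moreover have "(\<Sum>k<n. angle k l * outer q (x k) i j) = h * (outer q (x l) i j + a * of_bool (i = j))"
      using fm[unfolded fourth_moment_iff_operator, rule_format, of "outer q (x l)"] kl
      by (simp add: trace_prod_eq_angle mtrace_outer norm)
    moreover have "(\<Sum>k<n. g k * outer q (x k) i j) = (\<Sum>k<n. angle k l * outer q (x k) i j)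
        - (\<Sum>k<n. h * of_bool (k = l) * outer q (x k) i j) - b * (\<Sum>k<n. outer q (x k) i j)"
      unfolding g_def by (simp only: left_diff_distrib sum_subtractf sum_distrib_left)
    ultimately have "(\<Sum>k<n. g k * outer q (x k) i j) = (h * a - b * c1) * of_bool (i = j)"
      unfolding frame by (simp add: algebra_simps)
    then show ?thesis
      using bal unfolding balanced_def b_def by auto
  qed
  have g_sum: "(\<Sum>k<n. g k) = 0" if "a = 0"
  proof -
    have "(\<Sum>k<n. h * of_bool (k = l)) = (\<Sum>k\<in>{l}. h)"
      by (rule sum.mono_neutral_cong_right) (use kl in auto)
    then have "(\<Sum>k<n. g k) = c1 * a - h - of_nat n * b"
      by (simp add: g_def sum_subtractf sum_angle kl)
    then show ?thesis
      using that bal[unfolded balanced_def] by (simp add: b_def)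
  qed
  have "(\<Sum>k<n. g k * shifted k u) = 0" for u
    using g_outer g_sum by (cases u) (simp add: sum_shifted)
  then have "g k = 0"
    using indep kl unfolding lin_indep_def by blast
  then show ?thesis
    unfolding b_def[symmetric] by (simp add: g_def algebra_simps)
qed

end

text \<open>The frame identity for the basis vector e_j, read at coordinate i.\<close>

lemma tight_frame_UNIV_outer:
  fixes x :: "nat \<Rightarrow> 'i::finite \<Rightarrow> 'a::field"
  assumes "q > 0" and "tight_frame q UNIV x n c"
  shows "(\<Sum>k<n. outer q (x k) i j) = c * of_bool (i = j)"
proof -
  define v :: "'i \<Rightarrow> 'a" where "v = (\<lambda>i. of_bool (i = j))"
  have "herm q u v = conjq q (u j)" for u
    unfolding herm_def v_def by (rule sum_of_bool_left)
  moreover have "(\<Sum>k<n. herm q (x k) v * x k i) = c * v i"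
    using assms by (simp add: tight_frame_def fun_eq_iff)
  ultimately show ?thesis
    by (simp add: outer_def v_def mult.commute)
qed

section \<open>Projective 2-designs and equiangular tight frames\<close>

lemma proj_2design_imp_equal_norm_tight_frame:
  fixes x :: "nat \<Rightarrow> 'i::finite \<Rightarrow> 'a::{field,finite}"
  assumes "q > 0" "proj_2design q x n a c1 c2"
  shows "equal_norm_tight_frame q n x a c1"
  by (intro equal_norm_tight_frame.intro tight_frame_UNIV_outer[OF assms(1)])
    (use assms(2) in \<open>auto simp: proj_2design_def\<close>)

lemma etf_imp_equal_norm_tight_frame:
  fixes x :: "nat \<Rightarrow> 'i::finite \<Rightarrow> 'a::{field,finite}"
  assumes "q > 0" "etf q UNIV x n a b c1"
  shows "equal_norm_tight_frame q n x a c1"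
  by (intro equal_norm_tight_frame.intro tight_frame_UNIV_outer[OF assms(1)])
    (use assms(2) in \<open>auto simp: etf_def\<close>)

lemma two_neq_0_if_odd_CHAR:
  assumes "odd CHAR('a::{field,finite})"
  shows "(2 :: 'a) \<noteq> 0"
proof
  assume "(2 :: 'a) = 0"
  then have "of_nat 2 = (0 :: 'a)" by simp
  then have "CHAR('a) dvd 2"
    unfolding of_nat_eq_0_iff_char_dvd .
  then have "CHAR('a) = 2"
    by (metis prime_CHAR_finite_field primes_dvd_imp_eq two_is_prime_nat)
  with assms show False by simp
qed

lemma proj_2design_square_imp_etf:
  fixes x :: "nat \<Rightarrow> 'i::finite \<Rightarrow> 'a::{field,finite}"
  assumes q: "q = CHAR('a) ^ m" and odd: "odd CHAR('a)"
    and design: "proj_2design q x n a c1 c2" and n: "n = CARD('i) ^ 2"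
  shows "\<exists>b. etf q UNIV x n a b c1 \<and> a ^ 2 \<noteq> b \<and> (a \<noteq> 0 \<longrightarrow> a ^ 2 - b = b * c1 / a) \<and>
    (a = 0 \<longrightarrow> of_nat CARD('i) = (- 1 :: 'a))"
proof -
  have "q > 0"
    using q prime_CHAR_finite_field[where ?'a = 'a] by (simp add: prime_gt_0_nat)
  then interpret equal_norm_tight_frame q n x a c1
    using design by (rule proj_2design_imp_equal_norm_tight_frame)
  note two = two_neq_0_if_odd_CHAR[OF odd]
  have tf: "tight_frame q UNIV x n c1" and tf2: "tight_frame q sym_space (\<lambda>k. tensor (x k) (x k)) n c2"
    and a: "in_Fq q a"
    using design by (auto simp: proj_2design_def)
  define h where "h = c2 / 2"
  have fm: "fourth_moment q x n h"
    unfolding h_def using two tf2 by (rule tight_frame_sym_space_imp_fourth_moment)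
  have "c2 \<noteq> 0"
    using zero_tight_frame_sym_space_length[OF q] tf2 n by blast
  then have h: "h \<noteq> 0"
    using two by (simp add: h_def)
  \<comment> \<open>If d \<noteq> -1 in the field, a c1 = h (d + 1) is nonzero. If d = -1, then n =
    d^2 = 1, so n a = d c1 reads a = -c1, while a c1 = 0.\<close>
  have bal: balanced
  proof (cases "of_nat CARD('i) = (- 1 :: 'a)")
    case False
    then have "a * c1 \<noteq> 0"
      using h fourth_moment_trace[OF fm] by (simp add: eq_neg_iff_add_eq_0)
    then show ?thesis
      by (simp add: balanced_def)
  next
    case True
    have n1: "of_nat n = (1 :: 'a)"
      unfolding n of_nat_power True by simp
    have "a = - c1"
      using trace_eq unfolding n1 True by simp
    moreover have "a * c1 = 0"
      using fourth_moment_trace[OF fm] unfolding True by simp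
    ultimately have "a = 0" "c1 = 0"
      by auto
    with n1 True show ?thesis
      unfolding balanced_def by blast
  qed
  have indep: "lin_indep shifted n"
    using fourth_moment_imp_lin_span[OF bal fm h]
    by (subst lin_indep_iff_lin_span) (simp_all add: n power2_eq_square)
  define b where "b = (if a = 0 then - h else h * a / c1)"
  have angle: "angle k l = h * of_bool (k = l) + b" if "k < n" "l < n" for k l
    unfolding b_def using fourth_moment_imp_equiangular[OF bal fm indep that] .
  have "0 < n"
    by (simp add: n)
  \<comment> \<open>The diagonal angle, at k = l = 0, identifies h.\<close>
  then have ab: "a ^ 2 - b = h"
    using angle[of 0 0] by (simp add: angle_diag)
  have "in_Fq q h"
    unfolding h_def using tf2 in_Fq_add[OF q in_Fq_1 in_Fq_1]
    by (intro in_Fq_divide) (simp_all add: tight_frame_def)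
  moreover have "odd q" "in_Fq q c1"
    using q odd tf by (simp_all add: tight_frame_def)
  ultimately have "in_Fq q b"
    unfolding b_def using a by (auto intro: in_Fq_uminus in_Fq_mult in_Fq_divide)
  then have "etf q UNIV x n a b c1"
    unfolding etf_def using a tf norm angle by (auto simp: angle_def)
  moreover have "a ^ 2 \<noteq> b" using ab h by auto
  moreover have "a ^ 2 - b = b * c1 / a" if "a \<noteq> 0"
    unfolding ab using that bal by (simp add: balanced_def b_def)
  moreover have "of_nat CARD('i) = (- 1 :: 'a)" if "a = 0"
    using bal that unfolding balanced_def by blast
  ultimately show ?thesis by blast
qed

text \<open>Independence gives n \<le> d^2 first; this bound excludes c2 = 0, after which spanning
  gives d^2 \<le> n. The constants of the design and of the frame are not assumed to agree.\<close>

lemma proj_2design_etf_imp_square: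
  fixes x :: "nat \<Rightarrow> 'i::finite \<Rightarrow> 'a::{field,finite}"
  assumes q: "q = CHAR('a) ^ m" and odd: "odd CHAR('a)"
    and design: "proj_2design q x n a' c1' c2"
    and etf: "etf q UNIV x n a b c1" and ab: "a ^ 2 \<noteq> b"
    and nz: "a \<noteq> 0 \<Longrightarrow> a ^ 2 - b = b * c1 / a"
    and z: "a = 0 \<Longrightarrow> of_nat CARD('i) = (- 1 :: 'a)"
  shows "n = CARD('i) ^ 2"
proof -
  have "q > 0"
    using q prime_CHAR_finite_field[where ?'a = 'a] by (simp add: prime_gt_0_nat)
  then interpret equal_norm_tight_frame q n x a c1
    using etf by (rule etf_imp_equal_norm_tight_frame)
  note two = two_neq_0_if_odd_CHAR[OF odd]
  have tf2: "tight_frame q sym_space (\<lambda>k. tensor (x k) (x k)) n c2"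
    using design by (auto simp: proj_2design_def)
  have equi: "angle k l = b" if "k < n" "l < n" "k \<noteq> l" for k l
    using etf that by (simp add: etf_def angle_def)
  have "CARD('i) \<le> n"
    using etf by (intro card_le_lin_span[of x]) (simp add: etf_def tight_frame_def)
  then have "0 < n"
    using zero_less_card_finite[where 'a = 'i] by linarith
  then have bal: balanced
    using equi ab nz z by (rule equiangular_imp_balanced)
  have "lin_indep shifted n"
    using bal equi ab by (rule equiangular_imp_lin_indep)
  then have le: "n \<le> CARD('i) ^ 2"
    using lin_indep_le_card[of shifted n] by (simp add: power2_eq_square)
  then have "c2 \<noteq> 0"
    using zero_tight_frame_sym_space_length[OF q] tf2 by fastforce
  then have "c2 / 2 \<noteq> 0"
    using two by simp
  then have "lin_span shifted n = UNIV"
    using bal tight_frame_sym_space_imp_fourth_moment[OF two tf2] by (intro fourth_moment_imp_lin_span)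
  then have "CARD('i) ^ 2 \<le> n"
    using card_le_lin_span[of shifted n] by (simp add: power2_eq_square)
  with le show ?thesis by simp
qed

text \<open>The d^2 independent shifted matrices span, so the operator identity holds for all M,
  with h = a^2 - b \<noteq> 0.\<close>

lemma square_etf_imp_proj_2design:
  fixes x :: "nat \<Rightarrow> 'i::finite \<Rightarrow> 'a::{field,finite}"
  assumes q: "q = CHAR('a) ^ m" and odd: "odd CHAR('a)"
    and n: "n = CARD('i) ^ 2"
    and etf: "etf q UNIV x n a b c1" and ab: "a ^ 2 \<noteq> b"
    and nz: "a \<noteq> 0 \<Longrightarrow> a ^ 2 - b = b * c1 / a"
    and z: "a = 0 \<Longrightarrow> of_nat CARD('i) = (- 1 :: 'a)"
  shows "proj_2design q x n a c1 (2 * (a ^ 2 - b))"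
proof -
  have "q > 0"
    using q prime_CHAR_finite_field[where ?'a = 'a] by (simp add: prime_gt_0_nat)
  then interpret equal_norm_tight_frame q n x a c1
    using etf by (rule etf_imp_equal_norm_tight_frame)
  note two = two_neq_0_if_odd_CHAR[OF odd]
  have equi: "angle k l = b" if "k < n" "l < n" "k \<noteq> l" for k l
    using etf that by (simp add: etf_def angle_def)
  have "0 < n"
    by (simp add: n)
  then have bal: balanced
    using equi ab nz z by (rule equiangular_imp_balanced)
  have "lin_indep shifted n"
    using bal equi ab by (rule equiangular_imp_lin_indep)
  then have "lin_span shifted n = UNIV"
    by (subst (asm) lin_indep_iff_lin_span) (simp_all add: n power2_eq_square)
  with bal equi nz have fm: "fourth_moment q x n (a ^ 2 - b)"
    by (rule equiangular_imp_fourth_moment)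
  have "in_Fq q (2 * (a ^ 2 - b))"
  proof -
    have "odd q" "in_Fq q a" "in_Fq q b"
      using q odd etf by (simp_all add: etf_def)
    then have "in_Fq q (a ^ 2 - b)"
      using in_Fq_add[OF q in_Fq_mult in_Fq_uminus] by (simp add: power2_eq_square)
    then show ?thesis
      using in_Fq_add[OF q in_Fq_1 in_Fq_1] by (intro in_Fq_mult) simp_all
  qed
  with ab have "tight_frame q sym_space (\<lambda>k. tensor (x k) (x k)) n (2 * (a ^ 2 - b))"
    using \<open>q > 0\<close> two fm by (intro fourth_moment_imp_tight_frame_sym_space) simp_all
  then show ?thesis
    using etf by (simp add: proj_2design_def etf_def)
qed

theorem mainTheorem10:
  fixes x :: "nat \<Rightarrow> ('i::finite \<Rightarrow> 'a::{field,finite})"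
    and q p m n :: nat
  assumes "prime p" and "odd p" and "m \<ge> 1" and "q = p ^ m"
    and "CARD('a) = q ^ 2"
  defines "A \<equiv> (\<exists>a c1 c2. proj_2design q x n a c1 c2)"
    and "B \<equiv> (n = CARD('i) ^ 2)"
    and "C \<equiv> (\<lambda>a b c1. in_Fq q a \<and> in_Fq q b \<and> in_Fq q c1 \<and> a ^ 2 \<noteq> b \<and>
               (a \<noteq> 0 \<longrightarrow> a ^ 2 - b = b * c1 / a) \<and>
               (a = 0 \<longrightarrow> p dvd (CARD('i) + 1)) \<and>
               etf q UNIV x n a b c1)"
  shows "(A \<and> B \<longrightarrow> (\<exists>a b c1. C a b c1)) \<and>
         (A \<and> (\<exists>a b c1. C a b c1) \<longrightarrow> B) \<and>
         (B \<and> (\<exists>a b c1. C a b c1) \<longrightarrow> A) \<and>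
         (\<forall>a b c1. A \<and> B \<and> C a b c1 \<longrightarrow> proj_2design q x n a c1 (2 * (a ^ 2 - b)))"
proof -
  have "CHAR('a) dvd p ^ (m * 2)"
    using CHAR_dvd_CARD[where ?'a = 'a] assms(4,5) by (simp add: power_mult)
  then have p: "CHAR('a) = p"
    using prime_CHAR_finite_field \<open>prime p\<close> by (metis prime_dvd_power primes_dvd_imp_eq)
  then have q: "q = CHAR('a) ^ m" and odd: "odd CHAR('a)"
    using assms(2,4) by simp_all
  \<comment> \<open>The congruence d \<equiv> -1 modulo p becomes an equation in the field, whose
    characteristic is p.\<close>
  have d: "p dvd (CARD('i) + 1) \<longleftrightarrow> of_nat CARD('i) = (- 1 :: 'a)"
    unfolding p[symmetric] of_nat_eq_0_iff_char_dvd[symmetric] by (simp add: eq_neg_iff_add_eq_0 add.commute)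
  have C_iff: "C a b c1 \<longleftrightarrow> etf q UNIV x n a b c1 \<and> a ^ 2 \<noteq> b \<and>
      (a \<noteq> 0 \<longrightarrow> a ^ 2 - b = b * c1 / a) \<and> (a = 0 \<longrightarrow> of_nat CARD('i) = (- 1 :: 'a))" for a b c1
    unfolding C_def d by (auto simp: etf_def tight_frame_def)
  have "\<exists>a b c1. C a b c1" if A B
  proof -
    obtain a c1 c2 where "proj_2design q x n a c1 c2"
      using \<open>A\<close> unfolding A_def by blast
    from proj_2design_square_imp_etf[OF q odd this] \<open>B\<close> show ?thesis
      unfolding C_iff B_def by blast
  qed
  moreover have B if A "C a b c1" for a b c1
    using that proj_2design_etf_imp_square[OF q odd] unfolding C_iff A_def B_def by blast
  moreover have "proj_2design q x n a c1 (2 * (a ^ 2 - b))" if B "C a b c1" for a b c1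
    using that square_etf_imp_proj_2design[OF q odd] unfolding C_iff B_def by blast
  ultimately show ?thesis
    unfolding A_def by blast
qed

end
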